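(* Let $A\in\mathbb{R}^{n\times n}$ be symmetric positive semidefinite, let $p\ge1$ be fixed, let $(w_j)_{j\ge1}$ be a sequence of independent standard Gaussian random vectors in $\mathbb{R}^n$, and for $M\ge1$ let $X_M=\left(\frac1M\sum_{j=1}^M w_j^TA^pw_j\right)^{1/p}$. Then, as $M\to\infty$, $X_M$ converges to $\|A\|_{S_p}$ in $L^1(\Omega,\mathcal{F},\mathbb{P})$ and in $L^2(\Omega,\mathcal{F},\mathbb{P})$.
   Context: For a symmetric positive semidefinite matrix $A\in\mathbb{R}^{n\times n}$ with eigenvalues $\lambda_1,\dots,\lambda_n\ge 0$ and $p\ge1$, the Schatten $p$-norm is $\|A\|_{S_p}=\big(\sum_{j=1}^n\lambda_j^p\big)^{1/p}=(\operatorname{tr}(A^p))^{1/p}$, where $A^p$ is defined through the spectral decomposition. The samples $w_j:\Omega\to\mathbb{R}^n$ are independent random vectors on a probability space $(\Omega,\mathcal{F},\mathbb{P})$ whose entries are independent standard normal random variables. *)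

theory Defs
  imports "HOL-Probability.Probability" "HOL-Computational_Algebra.Polynomial"
begin

definition symmetric_matrix :: "real^'n^'n \<Rightarrow> bool" where
  "symmetric_matrix A \<longleftrightarrow> transpose A = A"

definition pos_semidef :: "real^'n^'n \<Rightarrow> bool" where
  "pos_semidef A \<longleftrightarrow> symmetric_matrix A \<and> (\<forall>x. 0 \<le> x \<bullet> (A *v x))"

definition char_poly_matrix :: "real^'n^'n \<Rightarrow> real poly" where
  "char_poly_matrix A = det (mat [:0, 1:] - (\<chi> i j. [:A $ i $ j:]))"

text \<open>The real eigenvalues, listed with algebraic multiplicity; for a symmetric
  \<open>n \<times> n\<close> matrix this is the full list of \<open>n\<close> eigenvalues.\<close>

definition eigenvalues_mset :: "real^'n^'n \<Rightarrow> real multiset" where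
  "eigenvalues_mset A = proots (char_poly_matrix A)"

text \<open>For \<open>p \<ge> 1\<close> and positive semidefinite \<open>A\<close>; note \<open>0 powr p = 0\<close>.\<close>

definition schatten_norm :: "real \<Rightarrow> real^'n^'n \<Rightarrow> real" where
  "schatten_norm p A = (\<Sum>l\<in>#eigenvalues_mset A. l powr p) powr (1 / p)"

definition diag_matrix :: "real^'n \<Rightarrow> real^'n^'n" where
  "diag_matrix d = (\<chi> i j. if i = j then d $ i else 0)"

definition spectral_decomposition :: "real^'n^'n \<Rightarrow> real^'n^'n \<Rightarrow> real^'n \<Rightarrow> bool" where
  "spectral_decomposition A U d \<longleftrightarrow>
     orthogonal_matrix U \<and> A = U ** diag_matrix d ** transpose U"

text \<open>The matrix \<open>A\<^sup>p\<close>. For symmetric \<open>A\<close> a spectral decomposition exists, and the resulting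
  power is the same for all of them: if \<open>U D U\<^sup>T = V E V\<^sup>T\<close> and \<open>W = V\<^sup>T U\<close>,
  then \<open>W D = E W\<close>, and entrywise the same holds for the powers of \<open>D\<close> and \<open>E\<close>.\<close>

definition matrix_powr :: "real^'n^'n \<Rightarrow> real \<Rightarrow> real^'n^'n" where
  "matrix_powr A p =
     (THE B. \<exists>U d. spectral_decomposition A U d \<and>
                   B = U ** diag_matrix (\<chi> i. d $ i powr p) ** transpose U)"

definition std_gaussian_vector :: "'a measure \<Rightarrow> ('a \<Rightarrow> real^'n) \<Rightarrow> bool" where
  "std_gaussian_vector P X \<longleftrightarrow>
     prob_space.indep_vars P (\<lambda>_. borel) (\<lambda>i \<omega>. X \<omega> $ i) UNIV \<and>
     (\<forall>i. distributed P lborel (\<lambda>\<omega>. X \<omega> $ i) std_normal_density)"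

text \<open>Sequences of samples are indexed from 1; the value at index 0 is irrelevant.\<close>

definition indep_std_gaussian_seq :: "'a measure \<Rightarrow> (nat \<Rightarrow> 'a \<Rightarrow> real^'n) \<Rightarrow> bool" where
  "indep_std_gaussian_seq P w \<longleftrightarrow>
     prob_space.indep_vars P (\<lambda>_. borel) w {1..} \<and>
     (\<forall>j\<ge>1. std_gaussian_vector P (w j))"

definition schatten_estimator ::
    "real^'n^'n \<Rightarrow> real \<Rightarrow> (nat \<Rightarrow> 'a \<Rightarrow> real^'n) \<Rightarrow> nat \<Rightarrow> 'a \<Rightarrow> real" where
  "schatten_estimator A p w M \<omega> =
     (1 / real M * (\<Sum>j=1..M. w j \<omega> \<bullet> (matrix_powr A p *v w j \<omega>))) powr (1 / p)"

definition in_Lp :: "'a measure \<Rightarrow> real \<Rightarrow> ('a \<Rightarrow> real) \<Rightarrow> bool" where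
  "in_Lp P q X \<longleftrightarrow> X \<in> borel_measurable P \<and> integrable P (\<lambda>\<omega>. \<bar>X \<omega>\<bar> powr q)"

definition Lp_norm :: "'a measure \<Rightarrow> real \<Rightarrow> ('a \<Rightarrow> real) \<Rightarrow> real" where
  "Lp_norm P q X = (\<integral>\<omega>. \<bar>X \<omega>\<bar> powr q \<partial>P) powr (1 / q)"

text \<open>Convergence of a sequence \<open>X\<^sub>1, X\<^sub>2, \<dots>\<close>. The membership conditions
  matter because the Bochner integral of a non-integrable function is 0.\<close>

definition converges_in_Lp ::
    "'a measure \<Rightarrow> real \<Rightarrow> (nat \<Rightarrow> 'a \<Rightarrow> real) \<Rightarrow> ('a \<Rightarrow> real) \<Rightarrow> bool" where
  "converges_in_Lp P q X Y \<longleftrightarrow>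
     (\<forall>M\<ge>1. in_Lp P q (X M)) \<and> in_Lp P q Y \<and>
     (\<lambda>M. Lp_norm P q (\<lambda>\<omega>. X M \<omega> - Y \<omega>)) \<longlonglongrightarrow> 0"

end

(* By the spectral theorem A^p = U D^p U^T, so the quadratic form w^T A^p w is
   nonnegative with mean tr (A^p) = ||A||^p and a second moment bounded uniformly in the sample.
   Hence the sample mean S_M satisfies E (S_M - tr (A^p))^2 = O(1/M). The map x |-> x^(1/p) obeys
   |x^(1/p) - t^(1/p)| <= t^(1/p - 1) |x - t| for every fixed t > 0, all x >= 0, which carries the
   bound over to X_M; for t = 0 the form vanishes identically. L^1 follows from L^2. *)
theory Submission
  imports Defs
begin

subsection \<open>Spectral decomposition of symmetric matrices\<close>

text \<open>The two sides of the claim rest on different encodings: \<open>schatten_norm\<close>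
  reads the roots of a characteristic polynomial, while \<open>matrix_powr\<close> is a definite
  description over spectral decompositions. Both are expressed through the diagonal of one
  decomposition, which turns the norm into a root of the trace that the Gaussian mean produces. For
  p > 1 the root has infinite slope at 0, so it is not Lipschitz on the half-line, and the sample
  mean can come arbitrarily close to 0. The estimate survives because one of the two arguments is
  always the fixed limit, and the constant depends on that limit alone. The mean square error
  therefore carries over directly, without almost sure convergence or uniform integrability. Only
  the order of the error matters, so the second moment of the quadratic form is bounded through the
  operator norm instead of being computed from mixed fourth moments.\<close>

lemma symmetric_matrix_inner:
  fixes A :: "real^'n^'n"
  assumes "symmetric_matrix A"
  shows "x \<bullet> (A *v y) = (A *v x) \<bullet> y"
  using assms unfolding symmetric_matrix_def
  by (metis dot_lmul_matrix transpose_matrix_vector)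

text \<open>A maximiser of the Rayleigh quotient on an invariant subspace is an eigenvector.\<close>

lemma symmetric_eigenvector_orthogonal_to:
  fixes A :: "real^'n^'n"
  assumes sym: "symmetric_matrix A"
    and eig: "\<And>f. f \<in> F \<Longrightarrow> \<exists>c. A *v f = c *\<^sub>R f"
    and x0: "x0 \<noteq> 0" "\<And>f. f \<in> F \<Longrightarrow> f \<bullet> x0 = 0"
  obtains x c where "norm x = 1" "\<And>f. f \<in> F \<Longrightarrow> f \<bullet> x = 0" "A *v x = c *\<^sub>R x"
proof -
  define S where "S = (\<Inter>f\<in>F. {x. f \<bullet> x = 0})"
  have S_iff: "x \<in> S \<longleftrightarrow> (\<forall>f\<in>F. f \<bullet> x = 0)" for x
    by (auto simp: S_def)
  have S_add: "x + y \<in> S" if "x \<in> S" "y \<in> S" for x y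
    using that by (auto simp: S_iff inner_add_right)
  have S_scale: "a *\<^sub>R x \<in> S" if "x \<in> S" for a x
    using that by (auto simp: S_iff)
  have S_inv: "A *v x \<in> S" if "x \<in> S" for x
  proof -
    have "f \<bullet> (A *v x) = 0" if f: "f \<in> F" for f
    proof -
      obtain c where "A *v f = c *\<^sub>R f" using eig[OF f] by blast
      then show ?thesis
        using f \<open>x \<in> S\<close> by (simp add: symmetric_matrix_inner[OF sym] S_iff)
    qed
    then show ?thesis by (simp add: S_iff)
  qed
  have "closed S"
    unfolding S_def by (intro closed_INT ballI closed_hyperplane)
  then have comp: "compact (sphere 0 1 \<inter> S)"
    by (intro compact_Int_closed) auto
  have "x0 /\<^sub>R norm x0 \<in> sphere 0 1 \<inter> S"
    using x0 by (auto simp: S_iff)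
  then have ne: "sphere 0 1 \<inter> S \<noteq> {}" by blast
  have cont: "continuous_on (sphere 0 1 \<inter> S) (\<lambda>x. x \<bullet> (A *v x))"
    by (intro continuous_intros linear_continuous_on matrix_vector_mul_bounded_linear)
  obtain x where x: "x \<in> sphere 0 1 \<inter> S"
    and max: "\<And>y. y \<in> sphere 0 1 \<inter> S \<Longrightarrow> y \<bullet> (A *v y) \<le> x \<bullet> (A *v x)"
    using continuous_attains_sup[OF comp ne cont] by blast
  define c where "c = x \<bullet> (A *v x)"
  \<comment> \<open>\<open>g\<close> is nonnegative on \<open>S\<close> and vanishes at the
    maximiser \<open>x\<close>, so its first-order term at \<open>x\<close> vanishes along every
    direction in \<open>S\<close>. Along the residual \<open>r\<close> that term is
    \<open>- 2 * t * (r \<bullet> r)\<close>, which forces \<open>r = 0\<close>.\<close>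
  define g where "g y = c * (y \<bullet> y) - y \<bullet> (A *v y)" for y
  have g_nonneg: "0 \<le> g y" if "y \<in> S" for y
  proof (cases "y = 0")
    case False
    have "y /\<^sub>R norm y \<in> sphere 0 1 \<inter> S"
      using False S_scale[OF that] by simp
    from max[OF this] have "(y \<bullet> (A *v y)) / (norm y)\<^sup>2 \<le> c"
      by (simp add: c_def matrix_vector_mult_scaleR power2_eq_square divide_simps)
    then show ?thesis
      using False by (simp add: g_def power2_norm_eq_inner divide_simps)
  qed (simp add: g_def)
  have xx: "x \<bullet> x = 1" using x by (simp add: dot_square_norm)
  define r where "r = A *v x - c *\<^sub>R x"
  have "x \<in> S" using x by simp
  then have "A *v x + (-c) *\<^sub>R x \<in> S"
    by (intro S_add S_scale S_inv)
  then have rS: "r \<in> S" by (simp add: r_def)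
  have expand: "g (x + t *\<^sub>R r) = t\<^sup>2 * g r - 2 * t * (r \<bullet> r)" for t
  proof -
    have rAx: "r \<bullet> (A *v x) = r \<bullet> r + c * (r \<bullet> x)"
      by (simp add: r_def inner_diff_right)
    have xAr: "x \<bullet> (A *v r) = r \<bullet> r + c * (r \<bullet> x)"
      using symmetric_matrix_inner[OF sym, of x r] rAx by (simp add: inner_commute)
    have "A *v (x + t *\<^sub>R r) = A *v x + t *\<^sub>R (A *v r)"
      by (simp add: matrix_vector_right_distrib matrix_vector_mult_scaleR)
    then show ?thesis
      unfolding g_def
      by (simp add: inner_add_left inner_add_right xx xAr rAx inner_commute[of x r]
          c_def[symmetric] algebra_simps power2_eq_square)
  qed
  have "r \<bullet> r = 0"
  proof (rule ccontr)
    assume "r \<bullet> r \<noteq> 0"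
    then have pos: "r \<bullet> r > 0" by (simp add: order_less_le)
    have nn: "0 \<le> t\<^sup>2 * g r - 2 * t * (r \<bullet> r)" for t
      using g_nonneg[OF S_add[OF \<open>x \<in> S\<close> S_scale[OF rS, of t]]] expand by simp
    show False
    proof (cases "g r = 0")
      case True
      with nn[of 1] pos show False by simp
    next
      case False
      with g_nonneg[OF rS] have gp: "g r > 0" by simp
      \<comment> \<open>The chosen \<open>t\<close> minimises the quadratic polynomial
        \<open>t\<^sup>2 * g r - 2 * t * (r \<bullet> r)\<close>.\<close>
      have "0 \<le> - ((r \<bullet> r)\<^sup>2 / g r)"
        using nn[of "(r \<bullet> r) / g r"] gp by (simp add: power2_eq_square)
      moreover have "(r \<bullet> r)\<^sup>2 / g r > 0" using pos gp by simp
      ultimately show False by linarith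
    qed
  qed
  then have "A *v x = c *\<^sub>R x" by (simp add: r_def)
  with x show thesis by (intro that[of x c]) (auto simp: S_iff)
qed

text \<open>Induction on \<open>k\<close>: fewer vectors than the dimension span a proper subspace,
  so a nonzero vector orthogonal to all of them exists, and the previous lemma replaces it by a unit
  eigenvector that is still orthogonal to them.\<close>

lemma orthonormal_eigenvectors_exist:
  fixes A :: "real^'n^'n"
  assumes sym: "symmetric_matrix A" and "k \<le> CARD('n)"
  shows "\<exists>F. finite F \<and> card F = k \<and> pairwise orthogonal F \<and>
           (\<forall>f\<in>F. norm f = 1 \<and> (\<exists>c. A *v f = c *\<^sub>R f))"
  using assms(2)
proof (induction k)
  case 0
  then show ?case by (intro exI[of _ "{}"]) auto
next
  case (Suc k)
  then obtain F where F: "finite F" "card F = k" "pairwise orthogonal F"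
    "\<And>f. f \<in> F \<Longrightarrow> norm f = 1" "\<And>f. f \<in> F \<Longrightarrow> \<exists>c. A *v f = c *\<^sub>R f"
    by (metis Suc_leD)
  have "dim F \<le> card F" by (rule dim_le_card'[OF F(1)])
  then have "dim F < DIM(real^'n)" using F(2) Suc.prems by simp
  then obtain x0 where "x0 \<noteq> 0" "\<And>y. y \<in> span F \<Longrightarrow> orthogonal x0 y"
    by (rule orthogonal_to_subspace_exists) blast
  then have "x0 \<noteq> 0" "\<And>f. f \<in> F \<Longrightarrow> f \<bullet> x0 = 0"
    by (auto simp: orthogonal_def inner_commute span_base)
  from symmetric_eigenvector_orthogonal_to[OF sym F(5) this]
  obtain x c where x: "norm x = 1" "\<And>f. f \<in> F \<Longrightarrow> f \<bullet> x = 0" "A *v x = c *\<^sub>R x"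
    by blast
  have "x \<notin> F" using x(1) x(2)[of x] by auto
  then show ?case
    using F x
    by (intro exI[of _ "insert x F"])
      (auto simp: pairwise_insert orthogonal_def[of x] orthogonal_def[of _ x] inner_commute)
qed

section \<open>Diagonalisation and well-definedness of the matrix power\<close>

lemma diag_matrix_component [simp]: "diag_matrix d $ i $ j = (if i = j then d $ i else 0)"
  by (simp add: diag_matrix_def)

lemma matrix_mult_diag_component:
  "(M ** diag_matrix d) $ i $ j = M $ i $ j * d $ j"
  by (simp add: matrix_matrix_mult_def if_distrib[of "(*) _"] sum.delta' cong: if_cong)

lemma diag_mult_matrix_component:
  "(diag_matrix d ** M) $ i $ j = d $ i * M $ i $ j"
proof -
  have "(diag_matrix d ** M) $ i $ j = (\<Sum>k\<in>UNIV. if i = k then d $ i * M $ k $ j else 0)"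
    by (simp add: matrix_matrix_mult_def if_distrib[of "\<lambda>z. z * _"] cong: if_cong)
  then show ?thesis by simp
qed

text \<open>With orthonormal eigenvectors as the columns of \<open>U\<close>, the eigenvalue
  equations read column by column say that \<open>A ** U\<close> equals \<open>U\<close> times a
  diagonal matrix; multiplying by \<open>transpose U\<close> on the right gives the
  decomposition.\<close>

theorem spectral_theorem:
  fixes A :: "real^'n^'n"
  assumes sym: "symmetric_matrix A"
  obtains U d where "spectral_decomposition A U d"
proof -
  obtain F where F: "finite F" "card F = CARD('n)" "pairwise orthogonal F"
    "\<And>f. f \<in> F \<Longrightarrow> norm f = 1" "\<And>f. f \<in> F \<Longrightarrow> \<exists>c. A *v f = c *\<^sub>R f"
    using orthonormal_eigenvectors_exist[OF sym order.refl] by metis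
  \<comment> \<open>Columns are indexed by the type \<open>'n\<close>, so the set of eigenvectors
    has to be labelled by it.\<close>
  obtain h where h: "bij_betw h (UNIV :: 'n set) F"
    using finite_same_card_bij[of "UNIV :: 'n set" F] F by auto
  have hF: "h i \<in> F" for i using h by (auto simp: bij_betw_def)
  obtain c where c: "\<And>i. A *v h i = c i *\<^sub>R h i"
    using F(5)[OF hF] by metis
  define U :: "real^'n^'n" where "U = (\<chi> i j. h j $ i)"
  have colU: "column j U = h j" for j
    by (simp add: U_def column_def vec_eq_iff)
  have orth: "orthogonal_matrix U"
    unfolding orthogonal_matrix_orthonormal_columns colU
  proof (intro conjI allI impI)
    fix i j :: 'n assume "i \<noteq> j"
    then have "h i \<noteq> h j" using h by (auto simp: bij_betw_def inj_on_def)
    then show "orthogonal (h i) (h j)" using F(3) hF by (auto simp: pairwise_def)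
  qed (use F(4) hF in blast)
  have "A ** U = U ** diag_matrix (\<chi> i. c i)"
  proof -
    have "(A ** U) $ i $ j = (U ** diag_matrix (\<chi> i. c i)) $ i $ j" for i j
    proof -
      have "(A ** U) $ i $ j = (A *v h j) $ i"
        by (simp add: matrix_matrix_mult_def matrix_vector_mult_def U_def)
      also have "\<dots> = (U ** diag_matrix (\<chi> i. c i)) $ i $ j"
        by (simp add: c matrix_mult_diag_component U_def)
      finally show ?thesis .
    qed
    then show ?thesis by (simp add: vec_eq_iff)
  qed
  then have "A ** (U ** transpose U) = U ** diag_matrix (\<chi> i. c i) ** transpose U"
    by (simp add: matrix_mul_assoc)
  with orth have "spectral_decomposition A U (\<chi> i. c i)"
    by (simp add: spectral_decomposition_def orthogonal_matrix_def)
  then show thesis by (rule that)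
qed

text \<open>Discharges the definite description, so that the power may be computed from whichever
  decomposition is at hand.\<close>

lemma matrix_powr_eq:
  fixes A :: "real^'n^'n"
  assumes UD: "spectral_decomposition A U d"
  shows "matrix_powr A p = U ** diag_matrix (\<chi> i. d $ i powr p) ** transpose U"
  unfolding matrix_powr_def
proof (rule the_equality)
  show "\<exists>U' d'. spectral_decomposition A U' d' \<and>
      U ** diag_matrix (\<chi> i. d $ i powr p) ** transpose U =
      U' ** diag_matrix (\<chi> i. d' $ i powr p) ** transpose U'"
    using UD by blast
next
  fix B
  assume "\<exists>V e. spectral_decomposition A V e \<and>
      B = V ** diag_matrix (\<chi> i. e $ i powr p) ** transpose V"
  then obtain V e where V: "orthogonal_matrix V" "A = V ** diag_matrix e ** transpose V"
    and B: "B = V ** diag_matrix (\<chi> i. e $ i powr p) ** transpose V"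
    by (auto simp: spectral_decomposition_def)
  have U: "orthogonal_matrix U" "A = U ** diag_matrix d ** transpose U"
    using UD by (auto simp: spectral_decomposition_def)
  have UU: "transpose U ** U = mat 1" "U ** transpose U = mat 1"
    and VV: "transpose V ** V = mat 1" "V ** transpose V = mat 1"
    using U V by (auto simp: orthogonal_matrix_def)
  define W where "W = transpose V ** U"
  have "W ** diag_matrix d = transpose V ** (U ** diag_matrix d ** transpose U) ** U"
    by (simp add: W_def matrix_mul_assoc[symmetric] UU)
  also have "\<dots> = transpose V ** (V ** diag_matrix e ** transpose V) ** U"
    using U(2) V(2) by simp
  also have "\<dots> = (transpose V ** V) ** diag_matrix e ** W"
    by (simp add: W_def matrix_mul_assoc)
  finally have WD: "W ** diag_matrix d = diag_matrix e ** W" by (simp add: VV)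
  have ent: "W $ i $ j * d $ j = e $ i * W $ i $ j" for i j
    using arg_cong[OF WD, of "\<lambda>M. M $ i $ j"]
    by (simp add: matrix_mult_diag_component diag_mult_matrix_component)
  \<comment> \<open>A nonzero entry of \<open>W\<close> forces \<open>d $ j = e $ i\<close>, hence
    equal powers; at a zero entry both sides vanish.\<close>
  have "W $ i $ j * d $ j powr p = e $ i powr p * W $ i $ j" for i j
    using ent[of i j] by (cases "W $ i $ j = 0") auto
  then have "W ** diag_matrix (\<chi> i. d $ i powr p) = diag_matrix (\<chi> i. e $ i powr p) ** W"
    by (simp add: vec_eq_iff matrix_mult_diag_component diag_mult_matrix_component)
  \<comment> \<open>Multiplying by \<open>V\<close> and \<open>transpose U\<close> turns the
    intertwining relation into equality of the two candidates for the power.\<close>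
  then have "V ** (W ** diag_matrix (\<chi> i. d $ i powr p)) ** transpose U =
      V ** (diag_matrix (\<chi> i. e $ i powr p) ** W) ** transpose U" by simp
  moreover have "V ** (W ** diag_matrix (\<chi> i. d $ i powr p)) ** transpose U =
      (V ** transpose V) ** U ** diag_matrix (\<chi> i. d $ i powr p) ** transpose U"
    by (simp add: W_def matrix_mul_assoc)
  moreover have "V ** (diag_matrix (\<chi> i. e $ i powr p) ** W) ** transpose U =
      V ** diag_matrix (\<chi> i. e $ i powr p) ** transpose V ** (U ** transpose U)"
    by (simp add: W_def matrix_mul_assoc)
  ultimately show "B = U ** diag_matrix (\<chi> i. d $ i powr p) ** transpose U"
    by (simp add: B UU VV)
qed

section \<open>Characteristic polynomial and trace formula for the Schatten norm\<close>

text \<open>The embedding of real matrices into polynomial matrices respects products and the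
  identity, so a spectral decomposition can be carried into the determinant that defines the
  characteristic polynomial.\<close>

definition const_poly_matrix :: "real^'n^'m \<Rightarrow> real poly^'n^'m" where
  "const_poly_matrix A = (\<chi> i j. [:A $ i $ j:])"

lemma const_poly_sum: "[:\<Sum>i\<in>I. f i:] = (\<Sum>i\<in>I. [:f i:])"
  by (simp add: poly_eq_iff coeff_sum coeff_pCons split: nat.split)

lemma const_poly_matrix_mult:
  "const_poly_matrix (A ** B) = const_poly_matrix A ** const_poly_matrix B"
  by (simp add: const_poly_matrix_def matrix_matrix_mult_def vec_eq_iff const_poly_sum mult.commute)

lemma const_poly_matrix_mat_1: "const_poly_matrix (mat 1) = mat 1"
  by (simp add: const_poly_matrix_def mat_def vec_eq_iff one_pCons)

lemma mat_mult_component: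
  fixes M :: "'a::comm_ring_1^'n^'n"
  shows "(mat c ** M) $ i $ j = c * M $ i $ j" "(M ** mat c) $ i $ j = c * M $ i $ j"
proof -
  have "(mat c ** M) $ i $ j = (\<Sum>k\<in>UNIV. if i = k then c * M $ k $ j else 0)"
    by (simp add: matrix_matrix_mult_def mat_def if_distrib[of "(*) _"] if_distrib[of "\<lambda>z. z * _"] cong: if_cong)
  then show "(mat c ** M) $ i $ j = c * M $ i $ j" by simp
  have "(M ** mat c) $ i $ j = (\<Sum>k\<in>UNIV. if k = j then M $ i $ k * c else 0)"
    by (simp add: matrix_matrix_mult_def mat_def if_distrib[of "(*) _"] if_distrib[of "\<lambda>z. z * _"] cong: if_cong)
  then show "(M ** mat c) $ i $ j = c * M $ i $ j" by (simp add: mult.commute)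
qed

text \<open>Similarity invariance of the determinant over the polynomial ring: the scalar matrix
  \<open>X\<close> is central, so conjugation by \<open>K U\<close> takes
  \<open>X - K (diag_matrix d)\<close> to \<open>X - K A\<close>. The complete factorisation yields
  the roots with their multiplicities.\<close>

lemma char_poly_spectral_decomposition:
  fixes A :: "real^'n^'n"
  assumes "spectral_decomposition A U d"
  shows "char_poly_matrix A = (\<Prod>i\<in>UNIV. [:- d $ i, 1:])"
proof -
  define K where "K = (const_poly_matrix :: real^'n^'n \<Rightarrow> real poly^'n^'n)"
  define X where "X = (mat [:0, 1:] :: real poly^'n^'n)"
  have UU: "U ** transpose U = mat 1" and A: "A = U ** diag_matrix d ** transpose U"
    using assms by (auto simp: spectral_decomposition_def orthogonal_matrix_def)
  have KUU: "K U ** K (transpose U) = mat 1"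
    by (simp add: K_def UU const_poly_matrix_mat_1 flip: const_poly_matrix_mult)
  have "X ** M = M ** X" for M
    by (simp add: X_def vec_eq_iff mat_mult_component)
  from this[of "K U"] have XKU: "K U ** X ** K (transpose U) = X"
    by (metis KUU matrix_mul_assoc matrix_mul_rid)
  have sub: "M ** (N - L) = M ** N - M ** L" "(N - L) ** M = N ** M - L ** M"
    for M N L :: "real poly^'n^'n"
    by (simp_all add: matrix_matrix_mult_def vec_eq_iff sum_subtractf algebra_simps)
  have "char_poly_matrix A = det (X - K A)"
    by (simp add: char_poly_matrix_def X_def K_def const_poly_matrix_def)
  also have "X - K A = K U ** (X - K (diag_matrix d)) ** K (transpose U)"
    by (simp add: sub XKU[unfolded K_def] A K_def const_poly_matrix_mult)
  \<comment> \<open>Collecting the two outer factors into one product, which is the identity, makes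
    the value of \<open>det U\<close> irrelevant.\<close>
  also have "det \<dots> = det (K U ** K (transpose U)) * det (X - K (diag_matrix d))"
    by (simp add: det_mul mult_ac)
  also have "\<dots> = det (X - K (diag_matrix d))" by (simp add: KUU)
  also have "\<dots> = (\<Prod>i\<in>UNIV. (X - K (diag_matrix d)) $ i $ i)"
    by (rule det_diagonal) (simp add: X_def K_def const_poly_matrix_def mat_def)
  also have "\<dots> = (\<Prod>i\<in>UNIV. [:- d $ i, 1:])"
    by (simp add: X_def K_def const_poly_matrix_def mat_def)
  finally show ?thesis .
qed

lemma trace_spectral_decomposition:
  fixes A :: "real^'n^'n"
  assumes "spectral_decomposition A U d"
  shows "trace A = (\<Sum>i\<in>UNIV. d $ i)"
proof -
  have "trace A = trace (U ** (diag_matrix d ** transpose U))"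
    using assms by (simp add: spectral_decomposition_def matrix_mul_assoc)
  also have "\<dots> = trace (diag_matrix d ** (transpose U ** U))"
    by (subst trace_mul_sym) (simp add: matrix_mul_assoc)
  also have "\<dots> = (\<Sum>i\<in>UNIV. d $ i)"
    using assms by (simp add: spectral_decomposition_def orthogonal_matrix_def trace_def)
  finally show ?thesis .
qed

text \<open>The same \<open>U\<close> diagonalises the power, so the general facts on trace and
  quadratic form apply to it with the entries \<open>d $ i powr p\<close>.\<close>

lemma spectral_decomposition_matrix_powr:
  fixes A :: "real^'n^'n"
  assumes "spectral_decomposition A U d"
  shows "spectral_decomposition (matrix_powr A p) U (\<chi> i. d $ i powr p)"
  using assms matrix_powr_eq[OF assms] by (simp add: spectral_decomposition_def)

text \<open>The link between the two encodings: the linear factors of the characteristic polynomial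
  give the multiset of all \<open>d $ i\<close>, so the sum over eigenvalues is the trace of the
  power.\<close>

lemma schatten_norm_eq_trace:
  fixes A :: "real^'n^'n"
  assumes "symmetric_matrix A"
  shows "schatten_norm p A = trace (matrix_powr A p) powr (1 / p)"
proof -
  obtain U d where UD: "spectral_decomposition A U d"
    using spectral_theorem[OF assms] .
  have "eigenvalues_mset A = (\<Sum>i\<in>UNIV. {#d $ i#})"
    by (simp add: eigenvalues_mset_def char_poly_spectral_decomposition[OF UD] proots_prod)
  moreover have "(\<Sum>l\<in>#(\<Sum>i\<in>I. {#d $ i#}). l powr p) = (\<Sum>i\<in>I. d $ i powr p)"
    if "finite I" for I
    using that by induction auto
  ultimately show ?thesis
    by (simp add: schatten_norm_def
        trace_spectral_decomposition[OF spectral_decomposition_matrix_powr[OF UD]])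
qed

section \<open>Quadratic forms in eigenbasis coordinates\<close>

lemma quadratic_form_spectral_decomposition:
  fixes A :: "real^'n^'n"
  assumes "spectral_decomposition A U d"
  shows "x \<bullet> (A *v x) = (\<Sum>i\<in>UNIV. d $ i * ((transpose U *v x) $ i)\<^sup>2)"
proof -
  define y where "y = transpose U *v x"
  have "x \<bullet> (A *v x) = x \<bullet> (U *v (diag_matrix d *v y))"
    using assms by (simp add: spectral_decomposition_def y_def matrix_vector_mul_assoc
        matrix_mul_assoc del: transpose_matrix_vector)
  also have "\<dots> = y \<bullet> (diag_matrix d *v y)"
    by (simp add: y_def dot_lmul_matrix)
  also have "\<dots> = (\<Sum>i\<in>UNIV. d $ i * (y $ i)\<^sup>2)"
    by (simp add: inner_vec_def matrix_vector_mult_def if_distrib[of "\<lambda>z. z * _"]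
        power2_eq_square mult.left_commute cong: if_cong)
  finally show ?thesis by (simp add: y_def)
qed

lemma matrix_powr_quadratic_form_nonneg:
  fixes A :: "real^'n^'n"
  assumes "symmetric_matrix A"
  shows "0 \<le> x \<bullet> (matrix_powr A p *v x)"
proof -
  obtain U d where UD: "spectral_decomposition A U d"
    using spectral_theorem[OF assms] .
  show ?thesis
    unfolding quadratic_form_spectral_decomposition[OF spectral_decomposition_matrix_powr[OF UD]]
    by (intro sum_nonneg) simp
qed

lemma matrix_powr_trace_nonneg:
  fixes A :: "real^'n^'n"
  assumes "symmetric_matrix A"
  shows "0 \<le> trace (matrix_powr A p)"
proof -
  obtain U d where UD: "spectral_decomposition A U d"
    using spectral_theorem[OF assms] .
  show ?thesis
    unfolding trace_spectral_decomposition[OF spectral_decomposition_matrix_powr[OF UD]]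
    by (intro sum_nonneg) simp
qed

text \<open>A vanishing sum of the nonnegative numbers \<open>d $ i powr p\<close> has only zero
  terms. This covers the limit 0, where no Lipschitz estimate for the root is available.\<close>

lemma matrix_powr_quadratic_form_eq_0:
  fixes A :: "real^'n^'n"
  assumes "symmetric_matrix A" and tr: "trace (matrix_powr A p) = 0"
  shows "x \<bullet> (matrix_powr A p *v x) = 0"
proof -
  obtain U d where UD: "spectral_decomposition A U d"
    using spectral_theorem[OF assms(1)] .
  note B = spectral_decomposition_matrix_powr[OF UD, of p]
  have "\<forall>i. d $ i powr p = 0"
    using tr unfolding trace_spectral_decomposition[OF B]
    by (subst (asm) sum_nonneg_eq_0_iff) auto
  then show ?thesis
    unfolding quadratic_form_spectral_decomposition[OF B] by simp
qed

subsection \<open>Square-integrable sample means\<close>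

text \<open>Dividing by \<open>y\<close> reduces the claim to \<open>y = 1\<close>, where
  \<open>t powr a\<close> lies between \<open>t\<close> and 1. Scaling back contributes
  \<open>y powr a\<close>, and rewriting \<open>t - 1\<close> as \<open>(x - y) / y\<close> lowers
  the exponent by one.\<close>

lemma powr_diff_le_Lipschitz:
  fixes x y a :: real
  assumes "0 \<le> x" "0 < y" "0 \<le> a" "a \<le> 1"
  shows "\<bar>x powr a - y powr a\<bar> \<le> y powr (a - 1) * \<bar>x - y\<bar>"
proof -
  define t where "t = x / y"
  have t: "0 \<le> t" and x: "x = y * t" using assms by (auto simp: t_def)
  have unit: "\<bar>t powr a - 1\<bar> \<le> \<bar>t - 1\<bar>"
  proof (cases "t \<ge> 1")
    case True
    then have "1 \<le> t powr a" "t powr a \<le> t"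
      using assms powr_mono[of a 1 t] by (auto intro: ge_one_powr_ge_zero)
    then show ?thesis by simp
  next
    case False
    then have "t \<le> t powr a" "t powr a \<le> 1"
      using assms t powr_mono'[of a 1 t] powr_mono2[of a t 1] by auto
    then show ?thesis using False by simp
  qed
  have "\<bar>x powr a - y powr a\<bar> = \<bar>y powr a * (t powr a - 1)\<bar>"
    using assms t by (simp add: x powr_mult algebra_simps)
  also have "\<dots> = y powr a * \<bar>t powr a - 1\<bar>"
    by (simp add: abs_mult)
  also have "\<dots> \<le> y powr a * \<bar>t - 1\<bar>"
    by (intro mult_left_mono unit) auto
  also have "\<dots> = y powr (a - 1) * \<bar>y * (t - 1)\<bar>"
    using assms by (simp add: abs_mult powr_diff)
  also have "y * (t - 1) = x - y" by (simp add: x algebra_simps)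
  finally show ?thesis .
qed

context prob_space
begin

lemma square_integrable_diff_const:
  fixes X :: "'a \<Rightarrow> real"
  assumes [measurable]: "random_variable borel X" and [simp]: "integrable M (\<lambda>\<omega>. (X \<omega>)\<^sup>2)"
  shows "integrable M (\<lambda>\<omega>. (X \<omega> - c)\<^sup>2)"
proof -
  have [simp]: "integrable M X"
    by (rule square_integrable_imp_integrable) auto
  show ?thesis by (simp add: power2_diff)
qed

text \<open>This is nonnegativity of the variance of the absolute value; it is how the
  \<open>L\<^sup>1\<close> claim follows from the \<open>L\<^sup>2\<close> one.\<close>

lemma expectation_abs_le_sqrt:
  fixes X :: "'a \<Rightarrow> real"
  assumes [measurable]: "random_variable borel X" and "integrable M (\<lambda>\<omega>. (X \<omega>)\<^sup>2)"
  shows "expectation (\<lambda>\<omega>. \<bar>X \<omega>\<bar>) \<le> sqrt (expectation (\<lambda>\<omega>. (X \<omega>)\<^sup>2))"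
proof -
  have "integrable M (\<lambda>\<omega>. \<bar>X \<omega>\<bar>)"
    using square_integrable_imp_integrable[OF assms] by simp
  then have "variance (\<lambda>\<omega>. \<bar>X \<omega>\<bar>) =
      expectation (\<lambda>\<omega>. (X \<omega>)\<^sup>2) - (expectation (\<lambda>\<omega>. \<bar>X \<omega>\<bar>))\<^sup>2"
    using assms by (subst variance_eq) auto
  then show ?thesis
    using variance_positive[of "\<lambda>\<omega>. \<bar>X \<omega>\<bar>"] by (intro real_le_rsqrt) simp
qed

lemma converges_in_L1_L2I:
  fixes X :: "nat \<Rightarrow> 'a \<Rightarrow> real"
  assumes [measurable]: "\<And>n. n \<ge> 1 \<Longrightarrow> random_variable borel (X n)"
    and sq: "\<And>n. n \<ge> 1 \<Longrightarrow> integrable M (\<lambda>\<omega>. (X n \<omega>)\<^sup>2)"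
    and lim: "(\<lambda>n. expectation (\<lambda>\<omega>. (X n \<omega> - c)\<^sup>2)) \<longlonglongrightarrow> 0"
  shows "converges_in_Lp M 1 X (\<lambda>_. c)" and "converges_in_Lp M 2 X (\<lambda>_. c)"
proof -
  have sqrt_lim: "(\<lambda>n. sqrt (expectation (\<lambda>\<omega>. (X n \<omega> - c)\<^sup>2))) \<longlonglongrightarrow> 0"
    using tendsto_real_sqrt[OF lim] by simp
  have L1: "Lp_norm M 1 (\<lambda>\<omega>. X n \<omega> - c) = expectation (\<lambda>\<omega>. \<bar>X n \<omega> - c\<bar>)" for n
    by (simp add: Lp_norm_def)
  have L2: "Lp_norm M 2 (\<lambda>\<omega>. X n \<omega> - c) = sqrt (expectation (\<lambda>\<omega>. (X n \<omega> - c)\<^sup>2))" for n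
    by (simp add: Lp_norm_def powr_half_sqrt)
  have "(\<lambda>n. expectation (\<lambda>\<omega>. \<bar>X n \<omega> - c\<bar>)) \<longlonglongrightarrow> 0"
  proof (rule tendsto_sandwich[OF _ _ tendsto_const sqrt_lim])
    \<comment> \<open>Measurability and integrability are given from index 1 on, so the comparison
      is made only eventually.\<close>
    show "\<forall>\<^sub>F n in sequentially. expectation (\<lambda>\<omega>. \<bar>X n \<omega> - c\<bar>)
        \<le> sqrt (expectation (\<lambda>\<omega>. (X n \<omega> - c)\<^sup>2))"
      using eventually_ge_at_top[of 1]
      by eventually_elim (auto intro!: expectation_abs_le_sqrt square_integrable_diff_const sq)
  qed simp
  moreover have "integrable M (\<lambda>\<omega>. \<bar>X n \<omega>\<bar>)" if "n \<ge> 1" for n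
    using square_integrable_imp_integrable[OF _ sq] that by simp
  ultimately show "converges_in_Lp M 1 X (\<lambda>_. c)"
    by (simp add: converges_in_Lp_def in_Lp_def L1)
  show "converges_in_Lp M 2 X (\<lambda>_. c)"
    using sq sqrt_lim by (simp add: converges_in_Lp_def in_Lp_def L2)
qed

lemma expectation_product_indep_vars:
  fixes Y :: "'i \<Rightarrow> 'a \<Rightarrow> real"
  assumes "indep_vars (\<lambda>_. borel) Y I" "i \<in> I" "j \<in> I" "i \<noteq> j"
    and "integrable M (Y i)" "integrable M (Y j)"
  shows "integrable M (\<lambda>\<omega>. Y i \<omega> * Y j \<omega>)"
    and "expectation (\<lambda>\<omega>. Y i \<omega> * Y j \<omega>) = expectation (Y i) * expectation (Y j)"
proof -
  have "indep_vars (\<lambda>_. borel) Y {i, j}"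
    using assms by (auto intro: indep_vars_subset)
  then show "integrable M (\<lambda>\<omega>. Y i \<omega> * Y j \<omega>)"
    and "expectation (\<lambda>\<omega>. Y i \<omega> * Y j \<omega>) = expectation (Y i) * expectation (Y j)"
    using indep_vars_integrable[of "{i, j}" Y] indep_vars_lebesgue_integral[of "{i, j}" Y] assms
    by auto
qed

text \<open>Expand the square into a double sum: by independence every off-diagonal term is a
  product of two zero means.\<close>

lemma expectation_square_sum_indep_centered:
  fixes Y :: "'i \<Rightarrow> 'a \<Rightarrow> real"
  assumes "finite I" and indep: "indep_vars (\<lambda>_. borel) Y I"
    and sq: "\<And>i. i \<in> I \<Longrightarrow> integrable M (\<lambda>\<omega>. (Y i \<omega>)\<^sup>2)"
    and mean: "\<And>i. i \<in> I \<Longrightarrow> expectation (Y i) = 0"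
  shows "integrable M (\<lambda>\<omega>. (\<Sum>i\<in>I. Y i \<omega>)\<^sup>2)"
    and "expectation (\<lambda>\<omega>. (\<Sum>i\<in>I. Y i \<omega>)\<^sup>2) = (\<Sum>i\<in>I. expectation (\<lambda>\<omega>. (Y i \<omega>)\<^sup>2))"
proof -
  have rv: "random_variable borel (Y i)" if "i \<in> I" for i
    using indep that by (auto simp: indep_vars_def)
  have int: "integrable M (Y i)" if "i \<in> I" for i
    using square_integrable_imp_integrable[OF rv sq] that by blast
  have prod_int: "integrable M (\<lambda>\<omega>. Y i \<omega> * Y j \<omega>)" if "i \<in> I" "j \<in> I" for i j
    using expectation_product_indep_vars(1)[OF indep that] int that sq
    by (cases "i = j") (auto simp: power2_eq_square)
  have prod_mean: "expectation (\<lambda>\<omega>. Y i \<omega> * Y j \<omega>) =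
      (if i = j then expectation (\<lambda>\<omega>. (Y i \<omega>)\<^sup>2) else 0)" if "i \<in> I" "j \<in> I" for i j
    using expectation_product_indep_vars(2)[OF indep that] int that mean
    by (auto simp: power2_eq_square)
  have expand: "(\<Sum>i\<in>I. Y i \<omega>)\<^sup>2 = (\<Sum>i\<in>I. \<Sum>j\<in>I. Y i \<omega> * Y j \<omega>)" for \<omega>
    by (simp add: power2_eq_square sum_product)
  show "integrable M (\<lambda>\<omega>. (\<Sum>i\<in>I. Y i \<omega>)\<^sup>2)"
    unfolding expand by (intro Bochner_Integration.integrable_sum prod_int)
  have "expectation (\<lambda>\<omega>. (\<Sum>i\<in>I. Y i \<omega>)\<^sup>2) = (\<Sum>i\<in>I. \<Sum>j\<in>I. expectation (\<lambda>\<omega>. Y i \<omega> * Y j \<omega>))"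
    unfolding expand
    by (subst Bochner_Integration.integral_sum; (intro Bochner_Integration.integrable_sum prod_int)?)
      (auto intro!: sum.cong Bochner_Integration.integral_sum prod_int)
  also have "\<dots> = (\<Sum>i\<in>I. expectation (\<lambda>\<omega>. (Y i \<omega>)\<^sup>2))"
    using \<open>finite I\<close> by (auto intro!: sum.cong simp: prod_mean)
  finally show "expectation (\<lambda>\<omega>. (\<Sum>i\<in>I. Y i \<omega>)\<^sup>2) = (\<Sum>i\<in>I. expectation (\<lambda>\<omega>. (Y i \<omega>)\<^sup>2))" .
qed

text \<open>After centring, the error is a sum of \<open>N\<close> independent terms divided by
  \<open>N\<close>. Each variance is at most \<open>K\<close>, so the mean square is at most
  \<open>N * K\<close> divided by the square of \<open>N\<close>.\<close>

lemma sample_mean_square_error: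
  fixes Q :: "nat \<Rightarrow> 'a \<Rightarrow> real"
  assumes indep: "indep_vars (\<lambda>_. borel) Q {1..}"
    and sq: "\<And>j. j \<ge> 1 \<Longrightarrow> integrable M (\<lambda>\<omega>. (Q j \<omega>)\<^sup>2)"
    and mean: "\<And>j. j \<ge> 1 \<Longrightarrow> expectation (Q j) = m"
    and bound: "\<And>j. j \<ge> 1 \<Longrightarrow> expectation (\<lambda>\<omega>. (Q j \<omega>)\<^sup>2) \<le> K"
    and N: "N \<ge> 1"
  shows "integrable M (\<lambda>\<omega>. (1 / real N * (\<Sum>j=1..N. Q j \<omega>) - m)\<^sup>2)"
    and "expectation (\<lambda>\<omega>. (1 / real N * (\<Sum>j=1..N. Q j \<omega>) - m)\<^sup>2) \<le> K / real N"
proof -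
  define Y where "Y j \<omega> = Q j \<omega> - m" for j \<omega>
  have rv: "random_variable borel (Q j)" if "j \<ge> 1" for j
    using indep that by (auto simp: indep_vars_def)
  have int: "integrable M (Q j)" if "j \<ge> 1" for j
    using square_integrable_imp_integrable[OF rv sq] that by blast
  have "indep_vars (\<lambda>_. borel) (\<lambda>j \<omega>. Q j \<omega> - m) {1..}"
    by (rule indep_vars_compose2[OF indep, where Y = "\<lambda>_ x. x - m"]) simp
  then have indY: "indep_vars (\<lambda>_. borel) Y {1..N}"
    by (auto simp: Y_def[abs_def] intro: indep_vars_subset)
  have sqY: "integrable M (\<lambda>\<omega>. (Y j \<omega>)\<^sup>2)" if "j \<in> {1..N}" for j
    using that by (auto simp: Y_def intro!: square_integrable_diff_const rv sq)
  have meanY: "expectation (Y j) = 0" if "j \<in> {1..N}" for j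
    using that int mean by (simp add: Y_def[abs_def] prob_space)
  have varY: "expectation (\<lambda>\<omega>. (Y j \<omega>)\<^sup>2) \<le> K" if "j \<in> {1..N}" for j
  proof -
    have j: "j \<ge> 1" using that by simp
    \<comment> \<open>The variance is the raw second moment minus a square, so the bound
      \<open>K\<close> on the former serves for both.\<close>
    have "expectation (\<lambda>\<omega>. (Y j \<omega>)\<^sup>2) = expectation (\<lambda>\<omega>. (Q j \<omega>)\<^sup>2) - m\<^sup>2"
      using variance_eq[OF int[OF j] sq[OF j]] by (simp add: Y_def mean[OF j])
    then show ?thesis using bound[OF j] by (smt (verit) zero_le_power2)
  qed
  have eq: "(1 / real N * (\<Sum>j=1..N. Q j \<omega>) - m)\<^sup>2 = (\<Sum>j=1..N. Y j \<omega>)\<^sup>2 / (real N)\<^sup>2" for \<omega>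
    using N by (simp add: Y_def sum_subtractf power_divide[symmetric] diff_divide_distrib)
  note S = expectation_square_sum_indep_centered[OF _ indY sqY meanY]
  show "integrable M (\<lambda>\<omega>. (1 / real N * (\<Sum>j=1..N. Q j \<omega>) - m)\<^sup>2)"
    unfolding eq using S(1) by simp
  have "expectation (\<lambda>\<omega>. (1 / real N * (\<Sum>j=1..N. Q j \<omega>) - m)\<^sup>2) =
      (\<Sum>j=1..N. expectation (\<lambda>\<omega>. (Y j \<omega>)\<^sup>2)) / (real N)\<^sup>2"
    unfolding eq using S(2) by simp
  also have "\<dots> \<le> (\<Sum>j=1..N. K) / (real N)\<^sup>2"
    by (intro divide_right_mono sum_mono varY) auto
  also have "\<dots> = K / real N" using N by (simp add: power2_eq_square)
  finally show "expectation (\<lambda>\<omega>. (1 / real N * (\<Sum>j=1..N. Q j \<omega>) - m)\<^sup>2) \<le> K / real N" .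
qed

section \<open>Moments of Gaussian vectors and of their quadratic forms\<close>

lemma std_normal_moments:
  fixes X :: "'a \<Rightarrow> real"
  assumes X: "distributed M lborel X std_normal_density"
  shows "integrable M (\<lambda>\<omega>. X \<omega> ^ k)" and "expectation X = 0"
    and "expectation (\<lambda>\<omega>. (X \<omega>)\<^sup>2) = 1" and "expectation (\<lambda>\<omega>. X \<omega> ^ 4) = 3"
proof -
  show "integrable M (\<lambda>\<omega>. X \<omega> ^ k)"
    using integrable_std_normal_moment[of k]
    by (subst (asm) distributed_integrable[OF X]) auto
  have moment: "expectation (\<lambda>\<omega>. X \<omega> ^ k) = (\<integral>x. std_normal_density x * x ^ k \<partial>lborel)" for k
    by (rule distributed_integral[OF X, symmetric]) auto
  show "expectation X = 0"
    using moment[of 1] integral_std_normal_moment_odd[of 0] by simp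
  show "expectation (\<lambda>\<omega>. (X \<omega>)\<^sup>2) = 1"
    using moment[of 2] integral_std_normal_moment_even[of 1] by simp
  show "expectation (\<lambda>\<omega>. X \<omega> ^ 4) = 3"
    using moment[of 4] integral_std_normal_moment_even[of 2] by (simp add: fact_numeral)
qed

text \<open>For the mean, the products of coordinates have expectation 1 on the diagonal and 0 off
  it, which leaves the trace. For the second moment, Cauchy-Schwarz is applied twice, so that only
  fourth moments of single coordinates enter.\<close>

lemma std_gaussian_vector_quadratic_form:
  fixes B :: "real^'n^'n" and X :: "'a \<Rightarrow> real^'n"
  assumes X: "std_gaussian_vector M X" and [measurable]: "random_variable borel X"
  shows "integrable M (\<lambda>\<omega>. (X \<omega> \<bullet> (B *v X \<omega>))\<^sup>2)"
    and "expectation (\<lambda>\<omega>. X \<omega> \<bullet> (B *v X \<omega>)) = trace B"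
    and "expectation (\<lambda>\<omega>. (X \<omega> \<bullet> (B *v X \<omega>))\<^sup>2) \<le> 3 * (real CARD('n))\<^sup>2 * (onorm ((*v) B))\<^sup>2"
proof -
  define C where "C = onorm ((*v) B)"
  \<comment> \<open>An integrable majorant of the squared form; it supplies both integrability and
    the numerical bound.\<close>
  define R where "R \<omega> = real CARD('n) * C\<^sup>2 * (\<Sum>i\<in>UNIV. (X \<omega> $ i) ^ 4)" for \<omega>
  have indep: "indep_vars (\<lambda>_. borel) (\<lambda>i \<omega>. X \<omega> $ i) UNIV"
    and dist: "\<And>i. distributed M lborel (\<lambda>\<omega>. X \<omega> $ i) std_normal_density"
    using X by (auto simp: std_gaussian_vector_def)
  note moments = std_normal_moments[OF dist]
  have int1: "integrable M (\<lambda>\<omega>. X \<omega> $ i)" for i using moments(1)[of i 1] by simp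
  have meas [measurable]: "(\<lambda>\<omega>. X \<omega> \<bullet> (B *v X \<omega>)) \<in> borel_measurable M"
    by (rule measurable_compose[OF assms(2)])
      (intro borel_measurable_continuous_onI continuous_intros linear_continuous_on
        matrix_vector_mul_bounded_linear)
  have "\<bar>x \<bullet> (B *v x)\<bar> \<le> C * (norm x)\<^sup>2" for x
  proof -
    have "\<bar>x \<bullet> (B *v x)\<bar> \<le> norm x * norm (B *v x)" by (rule Cauchy_Schwarz_ineq2)
    also have "\<dots> \<le> norm x * (C * norm x)"
      unfolding C_def by (intro mult_left_mono onorm matrix_vector_mul_bounded_linear) auto
    finally show ?thesis by (simp add: power2_eq_square mult_ac)
  qed
  then have sq_le: "(x \<bullet> (B *v x))\<^sup>2 \<le> (C * (norm x)\<^sup>2)\<^sup>2" for x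
    using power_mono[of "\<bar>x \<bullet> (B *v x)\<bar>" "C * (norm x)\<^sup>2" 2] by simp
  \<comment> \<open>Cauchy-Schwarz for the squared coordinates against the constant vector 1, whence
    the factor \<open>CARD('n)\<close>.\<close>
  have norm4_le: "((norm x)\<^sup>2)\<^sup>2 \<le> real CARD('n) * (\<Sum>i\<in>UNIV. (x $ i) ^ 4)" for x :: "real^'n"
    using sum_squared_le_sum_of_squares[of "\<lambda>i. (x $ i)\<^sup>2" UNIV]
    by (simp add: power2_norm_eq_inner inner_vec_def mult.commute flip: power2_eq_square power_mult)
  have le: "(X \<omega> \<bullet> (B *v X \<omega>))\<^sup>2 \<le> R \<omega>" for \<omega>
  proof -
    have "(X \<omega> \<bullet> (B *v X \<omega>))\<^sup>2 \<le> C\<^sup>2 * ((norm (X \<omega>))\<^sup>2)\<^sup>2"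
      using sq_le[of "X \<omega>"] by (simp add: power_mult_distrib)
    also have "\<dots> \<le> C\<^sup>2 * (real CARD('n) * (\<Sum>i\<in>UNIV. (X \<omega> $ i) ^ 4))"
      by (intro mult_left_mono norm4_le) simp
    finally show ?thesis by (simp add: R_def mult_ac)
  qed
  have R_int: "integrable M R"
    unfolding R_def[abs_def]
    by (intro integrable_mult_right Bochner_Integration.integrable_sum moments(1))
  show sq: "integrable M (\<lambda>\<omega>. (X \<omega> \<bullet> (B *v X \<omega>))\<^sup>2)"
    by (rule Bochner_Integration.integrable_bound[OF R_int])
      (use le in \<open>auto intro!: AE_I2 order_trans[OF le]\<close>)
  have "expectation (\<lambda>\<omega>. (X \<omega> \<bullet> (B *v X \<omega>))\<^sup>2) \<le> expectation R"
    by (intro integral_mono sq R_int le)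
  \<comment> \<open>One factor \<open>CARD('n)\<close> stands in \<open>R\<close>, the other counts
    the coordinates, each with fourth moment 3.\<close>
  also have "expectation R = 3 * (real CARD('n))\<^sup>2 * C\<^sup>2"
    unfolding R_def[abs_def]
    by (simp add: Bochner_Integration.integral_sum moments power2_eq_square)
  finally show "expectation (\<lambda>\<omega>. (X \<omega> \<bullet> (B *v X \<omega>))\<^sup>2) \<le>
      3 * (real CARD('n))\<^sup>2 * (onorm ((*v) B))\<^sup>2"
    by (simp add: C_def)
  have prod_int: "integrable M (\<lambda>\<omega>. X \<omega> $ i * X \<omega> $ j)" for i j
    using expectation_product_indep_vars(1)[OF indep UNIV_I UNIV_I _ int1 int1, of i j] moments(1)[of i 2]
    by (cases "i = j") (auto simp: power2_eq_square)
  have prod_mean: "expectation (\<lambda>\<omega>. X \<omega> $ i * X \<omega> $ j) = (if i = j then 1 else 0)" for i j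
    using expectation_product_indep_vars(2)[OF indep UNIV_I UNIV_I _ int1 int1, of i j] moments(2,3)[of i]
    by (auto simp: power2_eq_square)
  have expand: "x \<bullet> (B *v x) = (\<Sum>i\<in>UNIV. \<Sum>j\<in>UNIV. B $ i $ j * (x $ i * x $ j))" for x
    by (simp add: inner_vec_def matrix_vector_mult_def sum_distrib_left mult_ac)
  have "expectation (\<lambda>\<omega>. X \<omega> \<bullet> (B *v X \<omega>)) =
      (\<Sum>i\<in>UNIV. \<Sum>j\<in>UNIV. B $ i $ j * expectation (\<lambda>\<omega>. X \<omega> $ i * X \<omega> $ j))"
    unfolding expand using prod_int
    by (simp add: Bochner_Integration.integral_sum Bochner_Integration.integrable_sum)
  then show "expectation (\<lambda>\<omega>. X \<omega> \<bullet> (B *v X \<omega>)) = trace B"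
    by (simp add: prod_mean trace_def if_distrib[of "(*) _"] cong: if_cong)
qed

end

subsection \<open>Convergence of the estimator\<close>

theorem mainTheorem7:
  fixes A :: "real^'n^'n" and p :: real
    and P :: "'a measure" and w :: "nat \<Rightarrow> 'a \<Rightarrow> real^'n"
  assumes "prob_space P"
    and "pos_semidef A"
    and "p \<ge> 1"
    and "indep_std_gaussian_seq P w"
  shows "converges_in_Lp P 1 (schatten_estimator A p w) (\<lambda>_. schatten_norm p A) \<and>
         converges_in_Lp P 2 (schatten_estimator A p w) (\<lambda>_. schatten_norm p A)"
proof -
  interpret prob_space P by fact
  define B where "B = matrix_powr A p"
  define T where "T = trace B"
  define Q where "Q j \<omega> = w j \<omega> \<bullet> (B *v w j \<omega>)" for j \<omega>
  define S where "S N \<omega> = 1 / real N * (\<Sum>j=1..N. Q j \<omega>)" for N \<omega>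
  define X where "X = schatten_estimator A p w"
  define c where "c = schatten_norm p A"
  define K where "K = 3 * (real CARD('n))\<^sup>2 * (onorm ((*v) B))\<^sup>2"
  define L where "L = T powr (1 / p - 1)"
  have sym: "symmetric_matrix A" using assms(2) by (simp add: pos_semidef_def)
  have X: "X N \<omega> = S N \<omega> powr (1 / p)" for N \<omega>
    by (simp add: X_def schatten_estimator_def S_def Q_def B_def)
  have c: "c = T powr (1 / p)"
    using schatten_norm_eq_trace[OF sym] by (simp add: c_def T_def B_def)
  have indep_w: "indep_vars (\<lambda>_. borel) w {1..}"
    and gauss: "\<And>j. j \<ge> 1 \<Longrightarrow> std_gaussian_vector P (w j)"
    using assms(4) by (auto simp: indep_std_gaussian_seq_def)
  have rv_w: "random_variable borel (w j)" if "j \<ge> 1" for j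
    using indep_w that by (auto simp: indep_vars_def)
  have indep: "indep_vars (\<lambda>_. borel) Q {1..}"
    unfolding Q_def[abs_def]
    by (rule indep_vars_compose2[OF indep_w, where Y = "\<lambda>_ x. x \<bullet> (B *v x)"])
      (intro borel_measurable_continuous_onI continuous_intros linear_continuous_on
        matrix_vector_mul_bounded_linear)
  then have rv_Q: "random_variable borel (Q j)" if "j \<ge> 1" for j
    using that by (auto simp: indep_vars_def)
  have Q: "integrable P (\<lambda>\<omega>. (Q j \<omega>)\<^sup>2)" "expectation (Q j) = T"
    "expectation (\<lambda>\<omega>. (Q j \<omega>)\<^sup>2) \<le> K" if "j \<ge> 1" for j
    using std_gaussian_vector_quadratic_form[OF gauss[OF that] rv_w[OF that], of B]
    by (simp_all add: Q_def[abs_def] T_def K_def)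
  have S_int: "integrable P (\<lambda>\<omega>. (S N \<omega> - T)\<^sup>2)"
    and S_le: "expectation (\<lambda>\<omega>. (S N \<omega> - T)\<^sup>2) \<le> K / real N" if "N \<ge> 1" for N
    using sample_mean_square_error[OF indep Q that] by (simp_all add: S_def)
  have S_nonneg: "0 \<le> S N \<omega>" for N \<omega>
    unfolding S_def Q_def B_def
    by (intro mult_nonneg_nonneg sum_nonneg matrix_powr_quadratic_form_nonneg sym) auto
  have X_diff: "(X N \<omega> - c)\<^sup>2 \<le> L\<^sup>2 * (S N \<omega> - T)\<^sup>2" for N \<omega>
  proof -
    have "\<bar>X N \<omega> - c\<bar> \<le> L * \<bar>S N \<omega> - T\<bar>"
    proof (cases "T = 0")
      \<comment> \<open>Every sample of the form is 0 here, and \<open>0 powr _ = 0\<close> makes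
        \<open>X N \<omega>\<close>, \<open>c\<close> and \<open>L\<close> zero, so both sides
        vanish.\<close>
      case True
      then show ?thesis
        using matrix_powr_quadratic_form_eq_0[OF sym, of p]
        by (simp add: X c S_def Q_def T_def B_def)
    next
      case False
      then have "0 < T"
        using matrix_powr_trace_nonneg[OF sym, of p] by (simp add: T_def B_def)
      then show ?thesis
        unfolding X c L_def using S_nonneg assms(3) by (intro powr_diff_le_Lipschitz) auto
    qed
    from power_mono[OF this, of 2] show ?thesis by (simp add: power_mult_distrib)
  qed
  have rv_X: "random_variable borel (X N)" if "N \<ge> 1" for N
  proof -
    have "random_variable borel (\<lambda>\<omega>. \<Sum>j=1..N. Q j \<omega>)"
      by (rule borel_measurable_sum) (simp add: rv_Q)
    then show ?thesis unfolding X[abs_def] S_def by measurable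
  qed
  have diff_int: "integrable P (\<lambda>\<omega>. (X N \<omega> - c)\<^sup>2)" if "N \<ge> 1" for N
  proof (rule Bochner_Integration.integrable_bound)
    show "integrable P (\<lambda>\<omega>. L\<^sup>2 * (S N \<omega> - T)\<^sup>2)" using S_int[OF that] by simp
    show "(\<lambda>\<omega>. (X N \<omega> - c)\<^sup>2) \<in> borel_measurable P" using rv_X[OF that] by measurable
  qed (simp add: X_diff)
  \<comment> \<open>Subtracting the constant \<open>- c\<close> from the centred variable undoes the
    shift.\<close>
  have X_int: "integrable P (\<lambda>\<omega>. (X N \<omega>)\<^sup>2)" if "N \<ge> 1" for N
    using square_integrable_diff_const[of "\<lambda>\<omega>. X N \<omega> - c" "- c"] diff_int[OF that] rv_X[OF that]
    by simp
  have "(\<lambda>N. expectation (\<lambda>\<omega>. (X N \<omega> - c)\<^sup>2)) \<longlonglongrightarrow> 0"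
  proof (rule tendsto_sandwich[where f = "\<lambda>_. 0" and h = "\<lambda>N. L\<^sup>2 * (K / real N)"])
    show "\<forall>\<^sub>F N in sequentially. expectation (\<lambda>\<omega>. (X N \<omega> - c)\<^sup>2) \<le> L\<^sup>2 * (K / real N)"
      using eventually_ge_at_top[of 1]
    proof eventually_elim
      case (elim N)
      have "expectation (\<lambda>\<omega>. (X N \<omega> - c)\<^sup>2) \<le> expectation (\<lambda>\<omega>. L\<^sup>2 * (S N \<omega> - T)\<^sup>2)"
        using diff_int[OF elim] S_int[OF elim] X_diff by (intro integral_mono) auto
      also have "\<dots> \<le> L\<^sup>2 * (K / real N)"
        using mult_left_mono[OF S_le[OF elim], of "L\<^sup>2"] by simp
      finally show ?case .
    qed
    show "(\<lambda>N. L\<^sup>2 * (K / real N)) \<longlonglongrightarrow> 0"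
      using tendsto_mult_left[OF lim_const_over_n[of K], of "L\<^sup>2"] by simp
  qed auto
  from converges_in_L1_L2I[OF rv_X X_int this] show ?thesis
    by (simp add: X_def c_def)
qed

end
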